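(* For every odd integer $n\ge 3$, we have $b(n)=(n+1)/2$.
   Context: The odd cover number $b(n)$ of the complete graph $K_n$ is the minimum number of complete bipartite graphs needed so that each edge of $K_n$ is in an odd number of these complete bipartite graphs. Here a complete bipartite graph is specified by two disjoint sets $A_1,A_2$ of vertices of $K_n$ (not necessarily covering the whole vertex set), and consists of all edges with one endpoint in $A_1$ and the other in $A_2$. *)

theory Defs
  imports Main
begin

definition complete_graph_edges :: "nat \<Rightarrow> nat set set" where
  "complete_graph_edges n = {e. e \<subseteq> {..<n} \<and> card e = 2}"

definition biclique_edges :: "'a set \<times> 'a set \<Rightarrow> 'a set set" where
  "biclique_edges B = {{u, v} | u v. u \<in> fst B \<and> v \<in> snd B}"

definition is_biclique :: "nat \<Rightarrow> nat set \<times> nat set \<Rightarrow> bool" where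
  "is_biclique n B \<longleftrightarrow> fst B \<subseteq> {..<n} \<and> snd B \<subseteq> {..<n} \<and> fst B \<inter> snd B = {}"

text \<open>A family is a list, so repetitions count with multiplicity, both for the parity
  and for the number of bicliques used. Empty sides are allowed; neither liberty affects the
  minimum, since bicliques without edges and equal pairs can be deleted.\<close>

definition odd_cover :: "nat \<Rightarrow> (nat set \<times> nat set) list \<Rightarrow> bool" where
  "odd_cover n Bs \<longleftrightarrow> (\<forall>B\<in>set Bs. is_biclique n B) \<and>
     (\<forall>e\<in>complete_graph_edges n. odd (length (filter (\<lambda>B. e \<in> biclique_edges B) Bs)))"

definition odd_cover_number :: "nat \<Rightarrow> nat" where
  "odd_cover_number n = (LEAST k. \<exists>Bs. odd_cover n Bs \<and> length Bs = k)"

text \<open>The minimum exists: the stars joining each vertex to all larger ones form an odd cover.\<close>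

lemma odd_cover_exists: "\<exists>Bs. odd_cover n Bs"
proof
  let ?f = "\<lambda>i. ({i}, {i<..<n})"
  show "odd_cover n (map ?f [0..<n])"
    unfolding odd_cover_def
  proof (intro conjI ballI)
    fix B assume "B \<in> set (map ?f [0..<n])"
    then show "is_biclique n B" by (auto simp: is_biclique_def)
  next
    fix e assume "e \<in> complete_graph_edges n"
    then obtain a b where "e = {a, b}" "a \<noteq> b" "a < n" "b < n"
      by (auto simp: complete_graph_edges_def card_2_iff)
    then obtain u v where e: "e = {u, v}" "u < v" "v < n"
      by (metis insert_commute linorder_neqE_nat)
    have iff: "e \<in> biclique_edges (?f i) \<longleftrightarrow> i = u" for i
      using e by (auto simp: biclique_edges_def doubleton_eq_iff)
    have "length (filter (\<lambda>B. e \<in> biclique_edges B) (map ?f [0..<n])) =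
      length (filter (\<lambda>i. i = u) [0..<n])"
      using iff by (simp add: filter_map o_def)
    also have "\<dots> = card {i. i < n \<and> i = u}"
      by (simp add: length_filter_conv_card cong: conj_cong)
    also have "{i. i < n \<and> i = u} = {u}" using e by auto
    finally show "odd (length (filter (\<lambda>B. e \<in> biclique_edges B) (map ?f [0..<n])))" by simp
  qed
qed

end

theory Submission
  imports Defs
begin

text \<open>
  Lower bound. Identify an even vertex set \<open>e\<close> with a vector over the two-element field. The
  adjacency matrix of the complete graph fixes \<open>e\<close>, so \<open>e\<close> is determined by the parities of
  its intersections with the \<open>2 k\<close> sides. If \<open>2 k \<le> n - 1\<close>, counting makes this map from even
  sets to parity patterns a bijection. The pattern whose only odd entry is at the second side of
  one biclique can only come from the first side of the same biclique; but the two sides are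
  disjoint, so that entry is even.

  Upper bound. On vertex pairs \<open>x\<^sub>i, y\<^sub>i\<close>, \<open>i \<le> p\<close>, the tripartite 3-graphs with parts
  \<open>{x\<^sub>i, y\<^sub>i}\<close>, \<open>{x\<^sub>j | j > i} \<union> {y\<^sub>j | j < i}\<close> and \<open>{y\<^sub>j | j > i} \<union> {x\<^sub>j | j < i}\<close>
  cover every triple an odd number of times. Their links at \<open>y\<^sub>p\<close> are \<open>p + 1\<close> bicliques
  on the remaining \<open>2 p + 1\<close> vertices.
\<close>

lemma edge_in_biclique_edges:
  "{u, v} \<in> biclique_edges B \<longleftrightarrow> v \<in> fst B \<and> u \<in> snd B \<or> v \<in> snd B \<and> u \<in> fst B"
  by (auto simp: biclique_edges_def doubleton_eq_iff)

definition even_sets :: "nat \<Rightarrow> nat set set" where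
  "even_sets n = {e. e \<subseteq> {..<n} \<and> even (card e)}"

lemma finite_even_sets: "finite (even_sets n)"
  by (rule finite_subset[of _ "Pow {..<n}"]) (auto simp: even_sets_def)

text \<open>Inserting the new vertex \<open>n\<close> repairs an odd cardinality, and deleting
  \<open>n\<close> undoes the repair.\<close>

lemma card_even_sets_ge: "2 ^ n \<le> card (even_sets (Suc n))"
proof -
  let ?f = "\<lambda>S. if even (card S) then S else insert n S"
  have inv: "?f S - {n} = S" if "S \<subseteq> {..<n}" for S
    using that by auto
  have "inj_on ?f (Pow {..<n})"
    by (rule inj_on_inverseI[where g = "\<lambda>e. e - {n}"]) (use inv in blast)
  moreover have "?f S \<in> even_sets (Suc n)" if "S \<subseteq> {..<n}" for S
  proof -
    have "finite S" "n \<notin> S" using that finite_subset by auto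
    then show ?thesis using that by (auto simp: even_sets_def less_Suc_eq)
  qed
  ultimately have "card (Pow {..<n}) \<le> card (even_sets (Suc n))"
    by (intro card_inj_on_le[OF _ _ finite_even_sets]) auto
  then show ?thesis by (simp add: card_Pow)
qed

definition side_parities :: "('a set \<times> 'a set) list \<Rightarrow> 'a set \<Rightarrow> nat set \<times> nat set" where
  "side_parities Bs e =
    ({i. i < length Bs \<and> odd (card (fst (Bs ! i) \<inter> e))},
     {i. i < length Bs \<and> odd (card (snd (Bs ! i) \<inter> e))})"

text \<open>A left inverse of \<open>side_parities\<close> on even sets. A vertex on one side of a
  biclique is adjacent to the opposite side, hence the crossed use of \<open>fst\<close> and
  \<open>snd\<close>.\<close>

definition even_set_of :: "nat \<Rightarrow> (nat set \<times> nat set) list \<Rightarrow> nat set \<times> nat set \<Rightarrow> nat set" where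
  "even_set_of n Bs P = {v. v < n \<and>
    odd (card {i. i < length Bs \<and>
      (v \<in> fst (Bs ! i) \<and> i \<in> snd P \<or> v \<in> snd (Bs ! i) \<and> i \<in> fst P)})}"

text \<open>Fix \<open>v\<close> and count modulo 2 the pairs of \<open>u\<close> in
  \<open>e\<close> and a biclique containing the edge from \<open>u\<close> to \<open>v\<close>.
  Summing over \<open>u\<close> first gives the decoded parity. Summing over bicliques first gives
  \<open>card (e - {v})\<close>, which is odd exactly for \<open>v\<close> in \<open>e\<close>, as
  \<open>e\<close> is even.\<close>

lemma even_set_of_side_parities:
  assumes cover: "odd_cover n Bs" and e: "e \<in> even_sets n"
  shows "even_set_of n Bs (side_parities Bs e) = e"
proof -
  let ?k = "length Bs"
  define A where "A i = fst (Bs ! i)" for i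
  define B where "B i = snd (Bs ! i)" for i
  have disj: "A i \<inter> B i = {}" if "i < ?k" for i
    using cover that unfolding odd_cover_def is_biclique_def A_def B_def by (meson nth_mem)
  have e': "e \<subseteq> {..<n}" "even (card e)" "finite e"
    using e finite_subset by (auto simp: even_sets_def)
  have "odd (card {i. i < ?k \<and> (v \<in> A i \<and> odd (card (B i \<inter> e)) \<or> v \<in> B i \<and> odd (card (A i \<inter> e)))})
      \<longleftrightarrow> v \<in> e" (is "odd (card ?I) \<longleftrightarrow> _") if "v < n" for v
  proof -
    define cov :: "nat \<Rightarrow> nat \<Rightarrow> nat" where
      "cov i u = (if v \<in> A i \<and> u \<in> B i \<or> v \<in> B i \<and> u \<in> A i then 1 else 0)" for i u
    have row: "odd (\<Sum>u\<in>e. cov i u) \<longleftrightarrow>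
        v \<in> A i \<and> odd (card (B i \<inter> e)) \<or> v \<in> B i \<and> odd (card (A i \<inter> e))" if "i < ?k" for i
    proof -
      have *: "(\<Sum>u\<in>e. cov i u) = card {u \<in> e. v \<in> A i \<and> u \<in> B i \<or> v \<in> B i \<and> u \<in> A i}"
        unfolding cov_def using e' by (simp flip: sum.inter_filter)
      have "{u \<in> e. v \<in> A i \<and> u \<in> B i \<or> v \<in> B i \<and> u \<in> A i} =
          (if v \<in> A i then B i \<inter> e else if v \<in> B i then A i \<inter> e else {})"
        using disj[OF that] by auto
      then show ?thesis using * disj[OF that] by auto
    qed
    have column: "odd (\<Sum>i<?k. cov i u) \<longleftrightarrow> u \<noteq> v" if "u \<in> e" for u
    proof (cases "u = v")
      case True
      then have "cov i u = 0" if "i < ?k" for i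
        using disj[OF that] by (auto simp: cov_def)
      then show ?thesis using True by simp
    next
      case False
      have "(\<Sum>i<?k. cov i u) = card {i. i < ?k \<and> {u, v} \<in> biclique_edges (Bs ! i)}"
        unfolding cov_def edge_in_biclique_edges A_def B_def
        by (simp flip: sum.inter_filter)
      also have "\<dots> = length (filter (\<lambda>B. {u, v} \<in> biclique_edges B) Bs)"
        by (simp add: length_filter_conv_card)
      finally show ?thesis
        using False cover e' that \<open>v < n\<close>
        by (auto simp: odd_cover_def complete_graph_edges_def)
    qed
    have "odd (card ?I) \<longleftrightarrow> odd (card {i \<in> {..<?k}. odd (\<Sum>u\<in>e. cov i u)})"
      using row by (auto intro!: arg_cong[where f = "\<lambda>S. even (card S)"])
    also have "\<dots> \<longleftrightarrow> odd (\<Sum>i<?k. \<Sum>u\<in>e. cov i u)"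
      by (simp add: even_sum_iff)
    also have "(\<Sum>i<?k. \<Sum>u\<in>e. cov i u) = (\<Sum>u\<in>e. \<Sum>i<?k. cov i u)"
      by (rule sum.swap)
    also have "odd \<dots> \<longleftrightarrow> odd (card {u \<in> e. odd (\<Sum>i<?k. cov i u)})"
      using e' by (simp add: even_sum_iff)
    also have "{u \<in> e. odd (\<Sum>i<?k. cov i u)} = e - {v}"
      using column by auto
    also have "odd (card (e - {v})) \<longleftrightarrow> v \<in> e"
      using e' card_gt_0_iff[of e] by (cases "v \<in> e") auto
    finally show ?thesis .
  qed
  then show ?thesis
    using e' by (auto simp: even_set_of_def side_parities_def A_def B_def cong: conj_cong)
qed

lemma odd_cover_length_gt:
  assumes cover: "odd_cover n Bs" and "odd n" "n \<ge> 3"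
  shows "n < 2 * length Bs"
proof (rule ccontr)
  assume "\<not> n < 2 * length Bs"
  let ?k = "length Bs"
  let ?P = "Pow {..<?k} \<times> Pow {..<?k}"
  obtain m where m: "n = Suc m" using \<open>n \<ge> 3\<close> by (cases n) auto
  have inj: "inj_on (side_parities Bs) (even_sets n)"
    by (rule inj_on_inverseI[where g = "even_set_of n Bs"])
      (rule even_set_of_side_parities[OF cover])
  have sub: "side_parities Bs ` even_sets n \<subseteq> ?P"
    by (auto simp: side_parities_def)
  have card_P: "card ?P = 2 ^ (2 * ?k)"
    by (simp add: card_cartesian_product card_Pow power_add mult_2)
  have "(2::nat) ^ m \<le> 2 ^ (2 * ?k)"
    using card_even_sets_ge[of m] card_inj_on_le[OF inj sub] m unfolding card_P
    by (simp add: le_trans)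
  then have "m \<le> 2 * ?k" by simp
  \<comment> \<open>Oddness of \<open>n\<close> enters here: it excludes
    \<open>2 * ?k = m + 1\<close>, so both sides of the counting have size
    \<open>2 ^ m\<close>.\<close>
  then have k: "2 * ?k = m"
    using \<open>\<not> n < 2 * ?k\<close> \<open>odd n\<close> m by auto
  \<comment> \<open>The empty family covers the case \<open>n = 1\<close>; \<open>n \<ge> 3\<close>
    supplies a biclique of index \<open>0\<close>.\<close>
  then have "0 < ?k" using m \<open>n \<ge> 3\<close> by auto
  have "side_parities Bs ` even_sets n = ?P"
  proof (rule card_seteq[OF _ sub])
    show "card ?P \<le> card (side_parities Bs ` even_sets n)"
      using card_even_sets_ge[of m] unfolding card_image[OF inj] unfolding card_P k m .
  qed simp
  moreover have "({}, {0}) \<in> ?P" using \<open>0 < ?k\<close> by auto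
  ultimately obtain e where e: "e \<in> even_sets n" "side_parities Bs e = ({}, {0})"
    by (metis imageE)
  have bic: "is_biclique n (Bs ! 0)"
    using cover \<open>0 < ?k\<close> by (auto simp: odd_cover_def)
  have "{i. i < ?k \<and> v \<in> fst (Bs ! i) \<and> i = 0} = (if v \<in> fst (Bs ! 0) then {0} else {})" for v
    using \<open>0 < ?k\<close> by auto
  then have "even_set_of n Bs ({}, {0}) = fst (Bs ! 0)"
    using bic by (auto simp: even_set_of_def is_biclique_def)
  then have "e = fst (Bs ! 0)"
    using even_set_of_side_parities[OF cover e(1)] e(2) by simp
  moreover have "odd (card (snd (Bs ! 0) \<inter> e))"
    using e(2) by (auto simp: side_parities_def)
  ultimately show False
    using bic by (simp add: is_biclique_def Int_commute)
qed

text \<open>The vertices \<open>x\<^sub>i\<close> and \<open>y\<^sub>i\<close> are encoded as \<open>2 i\<close> and \<open>2 i + 1\<close>.\<close>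

definition link_biclique :: "nat \<Rightarrow> nat \<Rightarrow> nat set \<times> nat set" where
  "link_biclique p i =
    ({2 * i, 2 * i + 1},
     {v. even v \<and> 2 * i + 1 < v \<and> v < 2 * p + 1} \<union> {v. odd v \<and> v < 2 * i})"

text \<open>The apex \<open>y\<^sub>p\<close> is \<open>2 * p + 1\<close>, just outside the vertex
  range. For \<open>i < p\<close> it lies in the third part, so the link joins the first two; for
  \<open>i = p\<close> it lies in the first part, and the link joins the other two.\<close>

definition link_cover :: "nat \<Rightarrow> (nat set \<times> nat set) list" where
  "link_cover p = map (link_biclique p) [0..<p] @
    [({v. even v \<and> v < 2 * p}, {v. odd v \<and> v < 2 * p})]"

lemma odd_cover_link_cover: "odd_cover (2 * p + 1) (link_cover p)"
  unfolding odd_cover_def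
proof (intro conjI ballI)
  fix B assume "B \<in> set (link_cover p)"
  then show "is_biclique (2 * p + 1) B"
    by (auto simp: is_biclique_def link_cover_def link_biclique_def)
next
  fix e assume "e \<in> complete_graph_edges (2 * p + 1)"
  then obtain a b where "e = {a, b}" "a \<noteq> b" "a < 2 * p + 1" "b < 2 * p + 1"
    by (auto simp: complete_graph_edges_def card_2_iff)
  then obtain u v where e: "e = {u, v}" "u < v" "v < 2 * p + 1"
    by (metis insert_commute linorder_neqE_nat)
  let ?I = "{i. i < p \<and> e \<in> biclique_edges (link_biclique p i)}"
  \<comment> \<open>For an edge between two pairs, the lower pair contributes if \<open>v\<close> is
    an \<open>x\<close>, the upper pair if \<open>u\<close> is a \<open>y\<close>.\<close>
  have "e \<in> biclique_edges (link_biclique p i) \<longleftrightarrow>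
      u div 2 < v div 2 \<and> (i = u div 2 \<and> even v \<or> i = v div 2 \<and> odd u)" for i
  proof -
    have half: "w \<in> {2 * i, 2 * i + 1} \<longleftrightarrow> w div 2 = i" "2 * i + 1 < w \<longleftrightarrow> i < w div 2"
      "w < 2 * i \<longleftrightarrow> w div 2 < i" for w
      by auto
    have "u div 2 \<le> v div 2" using e(2) by (simp add: div_le_mono)
    then show ?thesis
      unfolding e(1) edge_in_biclique_edges link_biclique_def fst_conv snd_conv half Un_iff
        mem_Collect_eq
      using e(3) by auto
  qed
  then have I: "?I = {i. i < p \<and> u div 2 < v div 2 \<and> (i = u div 2 \<and> even v \<or> i = v div 2 \<and> odd u)}"
    by simp
  have len: "length (filter (\<lambda>B. e \<in> biclique_edges B) (link_cover p)) = card ?I +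
      (if v < 2 * p \<and> even u \<noteq> even v then 1 else 0)"
    using e(2) by (auto simp: link_cover_def filter_map o_def length_filter_conv_card
        e(1) edge_in_biclique_edges cong: conj_cong)
  show "odd (length (filter (\<lambda>B. e \<in> biclique_edges B) (link_cover p)))"
  proof (cases "u div 2 < v div 2")
    case False
    then have empty: "?I = {}" unfolding I by simp
    \<comment> \<open>An edge inside a pair is covered only by the last biclique.\<close>
    have "even u \<noteq> even v" "v < 2 * p"
      using False e(2,3) by presburger+
    then show ?thesis unfolding len empty by simp
  next
    case True
    have "u div 2 < p" using True e(3) by linarith
    have "v div 2 < p \<longleftrightarrow> v < 2 * p" by linarith
    have "?I = (if even v then {u div 2} else {}) \<union> (if odd u \<and> v < 2 * p then {v div 2} else {})"
      unfolding I using True \<open>u div 2 < p\<close> \<open>v div 2 < p \<longleftrightarrow> v < 2 * p\<close> by auto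
    \<comment> \<open>The vertex \<open>2 * p\<close> has no partner in range and avoids the last
      biclique, so only the lower pair covers its edges. For \<open>v < 2 * p\<close> the count is 3
      if \<open>u\<close> is odd and \<open>v\<close> even, and 1 otherwise.\<close>
    moreover have "v < 2 * p \<or> even v" using e(3) by (cases "v = 2 * p") auto
    ultimately show ?thesis unfolding len using True by auto
  qed
qed

theorem corollary2:
  fixes n :: nat
  assumes "odd n" and "n \<ge> 3"
  shows "odd_cover_number n = (n + 1) div 2"
  unfolding odd_cover_number_def
proof (rule Least_equality)
  obtain p where p: "n = 2 * p + 1" using \<open>odd n\<close> by (rule oddE)
  then show "\<exists>Bs. odd_cover n Bs \<and> length Bs = (n + 1) div 2"
    using odd_cover_link_cover[of p] by (intro exI[of _ "link_cover p"]) (simp add: link_cover_def)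
next
  fix k assume "\<exists>Bs. odd_cover n Bs \<and> length Bs = k"
  then have "n < 2 * k"
    using odd_cover_length_gt[OF _ assms] by auto
  then show "(n + 1) div 2 \<le> k"
    by linarith
qed

end
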